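(* Let $(G_i,X_i)_{i\ge 1}$ be a sequence in the space of marked groups $\mathcal{G}_m$ converging to $(G,X)\in\mathcal{G}_m$, where $G$ is finitely presented. For each $i$ let $\Gamma_i=\langle X_i\mid R_i\rangle$ be an arbitrary presentation of $G_i$ and let $\delta_i$ be the Dehn function of $G_i$ corresponding to $\Gamma_i$. Let $\Gamma=\langle X\mid R\rangle$ be any finite presentation of $G$, let $\delta$ be the Dehn function of $G$ corresponding to $\Gamma$, and let $L=\max_{r\in R}\|r\|$. Then for any $n\ge 0$, $$\limsup_{i}\frac{\delta_i(n)}{\delta_i(L)}\le \delta(n).$$
   Context: A marked group $(G,X)$ consists of a group $G$ and an $m$-tuple $X=(x_1,\dots,x_m)$ of elements generating $G$. Two marked groups $(G,X)$ and $(G',X')$ are regarded as the same if there is an isomorphism $G\to G'$ sending $x_j$ to $x'_j$ for every $j$; $\mathcal{G}_m$ is the set of all such marked groups. Let $\mathbb{F}$ be the free group on $m$ letters, with word length $\|\cdot\|$; through the correspondence of the $j$-th free letter with the $j$-th entry of the marking, $\mathbb{F}$ is identified with $F(X)$ and with $F(X_i)$ for every $i$. For $w\in\mathbb{F}$, $w_G$ denotes the image of $w$ in $G$ under the marking. For non-negative integers $\lambda$ put $\mathrm{Rel}_\lambda(G,X)=\{w\in\mathbb{F}:\|w\|\le\lambda,\ w_G=1\}$. The Gromov-Grigorchuk metric on $\mathcal{G}_m$ is $d((G,X),(G',X'))=e^{-\Lambda}$, where $\Lambda$ is the largest number such that $\mathrm{Rel}_\Lambda(G,X)=\mathrm{Rel}_\Lambda(G',X')$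 (and $d=0$ if the two marked groups are the same). Convergence in $\mathcal{G}_m$ is with respect to this metric. For a presentation $\langle X\mid R\rangle$ of $G$ ($X$ finite, $R\subseteq\mathbb{F}$, with $R$ possibly infinite; the presentation is finite if $R$ is finite), and $w\in\mathbb{F}$ with $w_G=1$, $\mathrm{Area}_R(w)$ is the smallest $k$ such that $w=\prod_{j=1}^k u_jr_j^{\pm1}u_j^{-1}$ in $\mathbb{F}$ for some $u_1,\dots,u_k\in\mathbb{F}$ and $r_1,\dots,r_k\in R$. The corresponding Dehn function is $\delta(n)=\max\{\mathrm{Area}_R(w): w\in\mathbb{F},\ w_G=1,\ \|w\|\le n\}$. *)

theory Defs
  imports
    "HOL-Library.Extended_Real"
    "HOL-Library.Liminf_Limsup"
    "HOL-Algebra.Generated_Groups"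
begin

section \<open>The free group on \<open>m\<close> letters\<close>

text \<open>The letter \<open>(True, j)\<close> stands for the \<open>j\<close>-th free generator and \<open>(False, j)\<close> for its
  inverse, where \<open>j < m\<close>.  Elements of the free group are the reduced words, so that the word
  length of an element is the length of the list.\<close>

type_synonym letter = "bool \<times> nat"

definition inv_letter :: "letter \<Rightarrow> letter" where
  "inv_letter a = (\<not> fst a, snd a)"

definition reduced :: "letter list \<Rightarrow> bool" where
  "reduced w \<longleftrightarrow> successively (\<lambda>a b. b \<noteq> inv_letter a) w"

text \<open>Left multiplication of a reduced word by a single letter.\<close>

fun mult_letter :: "letter \<Rightarrow> letter list \<Rightarrow> letter list" where
  "mult_letter a [] = [a]"
| "mult_letter a (b # w) = (if b = inv_letter a then w else a # b # w)"

definition free_group :: "nat \<Rightarrow> letter list monoid" where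
  "free_group m =
     \<lparr>carrier = {w. reduced w \<and> snd ` set w \<subseteq> {..<m}},
      monoid.mult = foldr mult_letter,
      one = []\<rparr>"

lemma inv_letter_inv_letter [simp]: "inv_letter (inv_letter a) = a"
  by (simp add: inv_letter_def)

lemma snd_inv_letter [simp]: "snd (inv_letter a) = snd a"
  by (simp add: inv_letter_def)

lemma reduced_Nil [simp]: "reduced []"
  by (simp add: reduced_def)

lemma reduced_Cons: "reduced (a # w) \<longleftrightarrow> (w = [] \<or> hd w \<noteq> inv_letter a) \<and> reduced w"
  by (auto simp: reduced_def successively_Cons)

lemma reduced_mult_letter: "reduced w \<Longrightarrow> reduced (mult_letter a w)"
  by (cases w) (auto simp: reduced_Cons)

lemma reduced_foldr_mult_letter: "reduced w \<Longrightarrow> reduced (foldr mult_letter u w)"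
  by (induction u) (auto intro: reduced_mult_letter)

lemma set_mult_letter: "set (mult_letter a w) \<subseteq> insert a (set w)"
  by (cases w) auto

lemma set_foldr_mult_letter: "set (foldr mult_letter u w) \<subseteq> set u \<union> set w"
proof (induction u)
  case (Cons a u)
  then show ?case using set_mult_letter[of a "foldr mult_letter u w"] by auto
qed simp

lemma mult_letter_cancel:
  assumes "reduced w"
  shows "mult_letter a (mult_letter (inv_letter a) w) = w"
proof (cases w)
  case (Cons b v)
  with assms show ?thesis by (cases v) (auto simp: reduced_Cons)
qed simp

lemma foldr_mult_letter_mult_letter:
  assumes "reduced w"
  shows "foldr mult_letter (mult_letter a u) w = mult_letter a (foldr mult_letter u w)"
proof (cases u)
  case (Cons b v)
  then show ?thesis
    using mult_letter_cancel[OF reduced_foldr_mult_letter[OF assms], of a v] by simp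
qed simp

lemma foldr_mult_letter_assoc:
  assumes "reduced w"
  shows "foldr mult_letter (foldr mult_letter u v) w
           = foldr mult_letter u (foldr mult_letter v w)"
  by (induction u) (simp_all add: foldr_mult_letter_mult_letter[OF assms])

lemma foldr_mult_letter_Nil: "reduced w \<Longrightarrow> foldr mult_letter w [] = w"
proof (induction w)
  case (Cons a w)
  then show ?case by (cases w) (auto simp: reduced_Cons)
qed simp

lemma foldr_mult_letter_inverse:
  assumes "reduced v"
  shows "foldr mult_letter (map inv_letter (rev w)) (foldr mult_letter w v) = v"
  using assms
proof (induction w arbitrary: v)
  case (Cons a w)
  have "mult_letter (inv_letter a) (mult_letter a (foldr mult_letter w v)) = foldr mult_letter w v"
    using mult_letter_cancel[OF reduced_foldr_mult_letter[OF Cons.prems], of "inv_letter a" w]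
    by simp
  with Cons show ?case by simp
qed simp

lemma group_free_group: "group (free_group m)"
proof (rule groupI)
  show "\<And>x y. x \<in> carrier (free_group m) \<Longrightarrow> y \<in> carrier (free_group m)
          \<Longrightarrow> x \<otimes>\<^bsub>free_group m\<^esub> y \<in> carrier (free_group m)"
    using set_foldr_mult_letter
    by (fastforce simp: free_group_def intro: reduced_foldr_mult_letter)
  show "\<exists>y\<in>carrier (free_group m). y \<otimes>\<^bsub>free_group m\<^esub> x = \<one>\<^bsub>free_group m\<^esub>"
    if x: "x \<in> carrier (free_group m)" for x
  proof
    let ?y = "foldr mult_letter (map inv_letter (rev x)) []"
    have "set ?y \<subseteq> inv_letter ` set x"
      using set_foldr_mult_letter[of "map inv_letter (rev x)" "[]"] by simp
    then show "?y \<in> carrier (free_group m)"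
      using x by (fastforce simp: free_group_def intro: reduced_foldr_mult_letter)
    have "foldr mult_letter ?y x = foldr mult_letter (map inv_letter (rev x)) (foldr mult_letter x [])"
      using x by (simp add: foldr_mult_letter_assoc foldr_mult_letter_Nil free_group_def)
    then show "?y \<otimes>\<^bsub>free_group m\<^esub> x = \<one>\<^bsub>free_group m\<^esub>"
      by (simp add: free_group_def foldr_mult_letter_inverse)
  qed
qed (auto simp: free_group_def foldr_mult_letter_assoc)


section \<open>Marked groups and the Gromov--Grigorchuk metric\<close>

text \<open>Elements of the space of marked groups are handled through representatives \<open>(G, X)\<close>; two
  representatives are identified by \<open>same_marked\<close>.\<close>

definition marked_groups :: "nat \<Rightarrow> ('a monoid \<times> 'a list) set" where
  "marked_groups m =
     {(G, X). group G \<and> length X = m \<and> set X \<subseteq> carrier G \<and> generate G (set X) = carrier G}"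

definition same_marked :: "'a monoid \<times> 'a list \<Rightarrow> 'b monoid \<times> 'b list \<Rightarrow> bool" where
  "same_marked P Q \<longleftrightarrow> (\<exists>h \<in> iso (fst P) (fst Q). map h (snd P) = snd Q)"

definition eval_letter :: "'a monoid \<times> 'a list \<Rightarrow> letter \<Rightarrow> 'a" where
  "eval_letter P a =
     (if fst a then snd P ! snd a else inv\<^bsub>fst P\<^esub> (snd P ! snd a))"

text \<open>The image in the marked group of a word in the free letters.\<close>

definition eval_word :: "'a monoid \<times> 'a list \<Rightarrow> letter list \<Rightarrow> 'a" where
  "eval_word P w = foldr (\<lambda>a g. eval_letter P a \<otimes>\<^bsub>fst P\<^esub> g) w \<one>\<^bsub>fst P\<^esub>"

definition Rel :: "nat \<Rightarrow> nat \<Rightarrow> 'a monoid \<times> 'a list \<Rightarrow> letter list set" where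
  "Rel m l P =
     {w \<in> carrier (free_group m). length w \<le> l \<and> eval_word P w = \<one>\<^bsub>fst P\<^esub>}"

definition gg_dist :: "nat \<Rightarrow> 'a monoid \<times> 'a list \<Rightarrow> 'b monoid \<times> 'b list \<Rightarrow> real" where
  "gg_dist m P Q =
     (if same_marked P Q then 0
      else exp (- real (GREATEST l. Rel m l P = Rel m l Q)))"


section \<open>Presentations and Dehn functions\<close>

definition normal_closure :: "('a, 'c) monoid_scheme \<Rightarrow> 'a set \<Rightarrow> 'a set" where
  "normal_closure G R = \<Inter>{N. N \<lhd> G \<and> R \<subseteq> N}"

definition is_presentation :: "nat \<Rightarrow> 'a monoid \<times> 'a list \<Rightarrow> letter list set \<Rightarrow> bool" where
  "is_presentation m P R \<longleftrightarrow>
     P \<in> marked_groups m \<and> R \<subseteq> carrier (free_group m) \<and>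
     kernel (free_group m) (fst P) (eval_word P) = normal_closure (free_group m) R"

definition relator_conjugates :: "nat \<Rightarrow> letter list set \<Rightarrow> letter list set" where
  "relator_conjugates m R =
     {u \<otimes>\<^bsub>free_group m\<^esub> s \<otimes>\<^bsub>free_group m\<^esub> inv\<^bsub>free_group m\<^esub> u | u s r.
        u \<in> carrier (free_group m) \<and> r \<in> R \<and> (s = r \<or> s = inv\<^bsub>free_group m\<^esub> r)}"

definition Area :: "nat \<Rightarrow> letter list set \<Rightarrow> letter list \<Rightarrow> nat" where
  "Area m R w =
     (LEAST k. \<exists>cs. length cs = k \<and> set cs \<subseteq> relator_conjugates m R \<and>
        w = foldr (\<otimes>\<^bsub>free_group m\<^esub>) cs \<one>\<^bsub>free_group m\<^esub>)"

definition Dehn :: "nat \<Rightarrow> 'a monoid \<times> 'a list \<Rightarrow> letter list set \<Rightarrow> nat \<Rightarrow> nat" where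
  "Dehn m P R n = Max (Area m R ` Rel m n P)"

text \<open>Inserting \<open>0\<close> only matters for the empty set of relators, where the maximum is taken
  to be \<open>0\<close>.\<close>

definition max_relator_length :: "letter list set \<Rightarrow> nat" where
  "max_relator_length R = Max (insert 0 (length ` R))"


section \<open>Well-definedness of the metric and of the Dehn function\<close>

lemma eval_letter_closed:
  assumes "(G, X) \<in> marked_groups m" "snd a < m"
  shows "eval_letter (G, X) a \<in> carrier G"
proof -
  interpret group G using assms by (simp add: marked_groups_def)
  have "X ! snd a \<in> carrier G" using assms by (auto simp: marked_groups_def)
  then show ?thesis by (simp add: eval_letter_def)
qed

lemma eval_word_closed:
  assumes "(G, X) \<in> marked_groups m" "snd ` set w \<subseteq> {..<m}"
  shows "eval_word (G, X) w \<in> carrier G"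
proof -
  interpret group G using assms by (simp add: marked_groups_def)
  show ?thesis using assms(2)
    by (induction w) (auto simp: eval_word_def intro!: eval_letter_closed[OF assms(1)])
qed

lemma eval_mult_letter:
  assumes P: "(G, X) \<in> marked_groups m" and a: "snd a < m" and w: "snd ` set w \<subseteq> {..<m}"
  shows "eval_word (G, X) (mult_letter a w) = eval_letter (G, X) a \<otimes>\<^bsub>G\<^esub> eval_word (G, X) w"
proof (cases w)
  case Nil
  then show ?thesis by (simp add: eval_word_def)
next
  case (Cons b v)
  interpret group G using P by (simp add: marked_groups_def)
  have Xa: "X ! snd a \<in> carrier G" using P a by (auto simp: marked_groups_def)
  have v: "eval_word (G, X) v \<in> carrier G"
    using eval_word_closed[OF P, of v] w Cons by auto
  show ?thesis
  proof (cases "b = inv_letter a")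
    case True
    have "eval_letter (G, X) a \<otimes>\<^bsub>G\<^esub> eval_letter (G, X) b = \<one>\<^bsub>G\<^esub>"
      using True Xa by (auto simp: eval_letter_def inv_letter_def)
    moreover have "eval_letter (G, X) a \<in> carrier G" "eval_letter (G, X) b \<in> carrier G"
      using True a by (auto intro: eval_letter_closed[OF P])
    moreover have "eval_word (G, X) w = eval_letter (G, X) b \<otimes>\<^bsub>G\<^esub> eval_word (G, X) v"
      using Cons by (simp add: eval_word_def)
    ultimately have "eval_letter (G, X) a \<otimes>\<^bsub>G\<^esub> eval_word (G, X) w = eval_word (G, X) v"
      using v by (metis m_assoc l_one)
    then show ?thesis using True Cons by simp
  next
    case False
    then show ?thesis using Cons by (simp add: eval_word_def)
  qed
qed

lemma eval_word_hom:
  assumes P: "(G, X) \<in> marked_groups m"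
  shows "eval_word (G, X) \<in> hom (free_group m) G"
proof (rule homI)
  interpret group G using P by (simp add: marked_groups_def)
  show "eval_word (G, X) u \<in> carrier G" if "u \<in> carrier (free_group m)" for u
    using that eval_word_closed[OF P] by (simp add: free_group_def)
  fix u v assume u: "u \<in> carrier (free_group m)" and v: "v \<in> carrier (free_group m)"
  have "eval_word (G, X) (foldr mult_letter u v) = eval_word (G, X) u \<otimes>\<^bsub>G\<^esub> eval_word (G, X) v"
    if "snd ` set u \<subseteq> {..<m}"
    using that
  proof (induction u)
    case Nil
    show ?case using eval_word_closed[OF P, of v] v by (simp add: eval_word_def free_group_def)
  next
    case (Cons a u)
    have uv: "snd ` set (foldr mult_letter u v) \<subseteq> {..<m}"
      using set_foldr_mult_letter[of u v] Cons.prems v by (fastforce simp: free_group_def)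
    have "eval_letter (G, X) a \<in> carrier G" "eval_word (G, X) u \<in> carrier G"
      "eval_word (G, X) v \<in> carrier G"
      using Cons.prems v
      by (auto simp: free_group_def intro!: eval_letter_closed[OF P] eval_word_closed[OF P])
    then show ?case
      using Cons eval_mult_letter[OF P _ uv, of a] by (simp add: eval_word_def m_assoc)
  qed
  then show "eval_word (G, X) (u \<otimes>\<^bsub>free_group m\<^esub> v) = eval_word (G, X) u \<otimes>\<^bsub>G\<^esub> eval_word (G, X) v"
    using u by (simp add: free_group_def)
qed

lemma eval_word_group_hom:
  assumes "(G, X) \<in> marked_groups m"
  shows "group_hom (free_group m) G (eval_word (G, X))"
  using assms eval_word_hom[OF assms] group_free_group
  by (simp add: group_hom_def group_hom_axioms_def marked_groups_def)

lemma generator_in_free_group: "j < m \<Longrightarrow> [(True, j)] \<in> carrier (free_group m)"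
  by (simp add: free_group_def reduced_def)

lemma eval_word_generator:
  assumes "(G, X) \<in> marked_groups m" "j < m"
  shows "eval_word (G, X) [(True, j)] = X ! j"
proof -
  interpret group G using assms by (simp add: marked_groups_def)
  have "X ! j \<in> carrier G" using assms by (auto simp: marked_groups_def)
  then show ?thesis by (simp add: eval_word_def eval_letter_def)
qed

lemma eval_word_surj:
  assumes P: "(G, X) \<in> marked_groups m"
  shows "eval_word (G, X) ` carrier (free_group m) = carrier G"
proof -
  interpret group_hom "free_group m" G "eval_word (G, X)" by (rule eval_word_group_hom[OF P])
  have "set X \<subseteq> eval_word (G, X) ` carrier (free_group m)"
  proof
    fix x assume "x \<in> set X"
    then obtain j where "j < m" "x = X ! j"
      using P by (auto simp: in_set_conv_nth marked_groups_def)
    then show "x \<in> eval_word (G, X) ` carrier (free_group m)"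
      using generator_in_free_group eval_word_generator[OF P] by (metis imageI)
  qed
  then have "generate G (set X) \<subseteq> eval_word (G, X) ` carrier (free_group m)"
    by (intro H.generate_subgroup_incl img_is_subgroup)
  then show ?thesis using P by (auto simp: marked_groups_def)
qed

text \<open>If two marked groups are not the same, then the set of all \<open>l\<close> with
  \<open>Rel m l P = Rel m l Q\<close> is bounded, so the greatest such \<open>l\<close> exists.\<close>

lemma same_marked_if_Rel_eq:
  assumes P: "P \<in> marked_groups m" and Q: "Q \<in> marked_groups m"
    and eq: "\<And>l. Rel m l P = Rel m l Q"
  shows "same_marked P Q"
proof -
  obtain G X H Y where PQ: "P = (G, X)" "Q = (H, Y)" by (metis surj_pair)
  let ?F = "free_group m" and ?p = "eval_word P" and ?q = "eval_word Q"
  interpret p: group_hom ?F G ?p using eval_word_group_hom P PQ by blast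
  interpret q: group_hom ?F H ?q using eval_word_group_hom Q PQ by blast
  have ker: "?p w = \<one>\<^bsub>G\<^esub> \<longleftrightarrow> ?q w = \<one>\<^bsub>H\<^esub>" if "w \<in> carrier ?F" for w
    using eq[of "length w"] that PQ by (auto simp: Rel_def)
  have key: "?p u = ?p v \<longleftrightarrow> ?q u = ?q v" if uv: "u \<in> carrier ?F" "v \<in> carrier ?F" for u v
  proof -
    have "?p (u \<otimes>\<^bsub>?F\<^esub> inv\<^bsub>?F\<^esub> v) = \<one>\<^bsub>G\<^esub> \<longleftrightarrow> ?p u = ?p v"
      using uv by (simp add: p.H.inv_solve_right')
    moreover have "?q (u \<otimes>\<^bsub>?F\<^esub> inv\<^bsub>?F\<^esub> v) = \<one>\<^bsub>H\<^esub> \<longleftrightarrow> ?q u = ?q v"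
      using uv by (simp add: q.H.inv_solve_right')
    ultimately show ?thesis using ker[of "u \<otimes>\<^bsub>?F\<^esub> inv\<^bsub>?F\<^esub> v"] uv by simp
  qed
  have surj: "?p ` carrier ?F = carrier G" "?q ` carrier ?F = carrier H"
    using eval_word_surj P Q PQ by blast+
  define h where "h g = ?q (SOME w. w \<in> carrier ?F \<and> ?p w = g)" for g
  have h: "h (?p w) = ?q w" if "w \<in> carrier ?F" for w
  proof -
    let ?v = "SOME v. v \<in> carrier ?F \<and> ?p v = ?p w"
    have "?v \<in> carrier ?F \<and> ?p ?v = ?p w"
      by (rule someI[of "\<lambda>v. v \<in> carrier ?F \<and> ?p v = ?p w" w]) (simp add: that)
    then have "?q ?v = ?q w" using key[of ?v w] that by blast
    then show ?thesis by (simp add: h_def)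
  qed
  have "h \<in> hom G H"
  proof (rule homI)
    show "h x \<in> carrier H" if "x \<in> carrier G" for x
      using that h surj by (metis imageE q.hom_closed)
    fix x y assume "x \<in> carrier G" "y \<in> carrier G"
    then obtain u v where uv: "u \<in> carrier ?F" "v \<in> carrier ?F" "x = ?p u" "y = ?p v"
      using surj by (metis imageE)
    then show "h (x \<otimes>\<^bsub>G\<^esub> y) = h x \<otimes>\<^bsub>H\<^esub> h y"
      using h[of "u \<otimes>\<^bsub>?F\<^esub> v"] h[of u] h[of v] by simp
  qed
  moreover have "bij_betw h (carrier G) (carrier H)"
  proof (rule bij_betw_imageI)
    show "inj_on h (carrier G)"
      unfolding surj(1)[symmetric] by (auto simp: inj_on_def h key)
    show "h ` carrier G = carrier H"
      unfolding surj[symmetric] by (simp add: image_image h)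
  qed
  ultimately have "h \<in> iso G H" by (simp add: iso_def)
  moreover have "map h X = Y"
  proof (rule nth_equalityI)
    show "length (map h X) = length Y" using P Q PQ by (simp add: marked_groups_def)
    fix j assume "j < length (map h X)"
    then have j: "j < m" "j < length X" using P PQ by (auto simp: marked_groups_def)
    then show "map h X ! j = Y ! j"
      using h[OF generator_in_free_group] eval_word_generator P Q PQ by (metis nth_map)
  qed
  ultimately show ?thesis using PQ by (auto simp: same_marked_def)
qed

lemma finite_Rel: "finite (Rel m l P)"
proof -
  have "Rel m l P \<subseteq> {w. set w \<subseteq> UNIV \<times> {..<m} \<and> length w \<le> l}"
    by (fastforce simp: Rel_def free_group_def)
  then show ?thesis by (rule finite_subset) (intro finite_lists_length_le, simp)
qed

lemma Nil_in_Rel: "[] \<in> Rel m l P"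
  by (simp add: Rel_def free_group_def eval_word_def)

end

theory Submission
  imports Defs
begin

text \<open>Once \<open>G\<^sub>i\<close> and \<open>G\<^sub>0\<close> have the same relations of length at most \<open>max n L\<close>, a word \<open>w\<close> of length
  at most \<open>n\<close> that is trivial in \<open>G\<^sub>i\<close> is trivial in \<open>G\<^sub>0\<close>, so it is a product of at most
  \<open>\<delta> n\<close> conjugates of relators of \<open>G\<^sub>0\<close> and their inverses.  These relators have length at most
  \<open>L\<close>, so each of them is a relation of \<open>G\<^sub>i\<close> of area at most \<open>\<delta>\<^sub>i L\<close>.  Hence
  \<open>\<delta>\<^sub>i n \<le> \<delta> n * \<delta>\<^sub>i L\<close>.\<close>

section \<open>Products of conjugates of relators\<close>

text \<open>This is the predicate under \<open>LEAST\<close> in \<open>Area\<close>. The number of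
  factors \<open>k\<close> is exact, so that counts can be added and compared.\<close>

definition conjugate_product :: "nat \<Rightarrow> letter list set \<Rightarrow> nat \<Rightarrow> letter list \<Rightarrow> bool" where
  "conjugate_product m R k w \<longleftrightarrow>
     (\<exists>cs. length cs = k \<and> set cs \<subseteq> relator_conjugates m R \<and>
        w = foldr (\<otimes>\<^bsub>free_group m\<^esub>) cs \<one>\<^bsub>free_group m\<^esub>)"

lemma relator_conjugates_closed:
  assumes "R \<subseteq> carrier (free_group m)"
  shows "relator_conjugates m R \<subseteq> carrier (free_group m)"
proof -
  interpret group "free_group m" by (rule group_free_group)
  show ?thesis using assms by (auto simp: relator_conjugates_def)
qed

text \<open>Conjugating once more by \<open>v\<close> only replaces the conjugator \<open>u\<close>
  by the product of \<open>v\<close> and \<open>u\<close>.\<close>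

lemma relator_conjugates_conj:
  assumes R: "R \<subseteq> carrier (free_group m)" and c: "c \<in> relator_conjugates m R"
    and v: "v \<in> carrier (free_group m)"
  shows "v \<otimes>\<^bsub>free_group m\<^esub> c \<otimes>\<^bsub>free_group m\<^esub> inv\<^bsub>free_group m\<^esub> v \<in> relator_conjugates m R"
proof -
  interpret group "free_group m" by (rule group_free_group)
  obtain u s r where u: "u \<in> carrier (free_group m)" and r: "r \<in> R"
    and s: "s = r \<or> s = inv\<^bsub>free_group m\<^esub> r"
    and c: "c = u \<otimes>\<^bsub>free_group m\<^esub> s \<otimes>\<^bsub>free_group m\<^esub> inv\<^bsub>free_group m\<^esub> u"
    using c by (auto simp: relator_conjugates_def)
  have "s \<in> carrier (free_group m)" using r s R by auto
  then have "v \<otimes>\<^bsub>free_group m\<^esub> c \<otimes>\<^bsub>free_group m\<^esub> inv\<^bsub>free_group m\<^esub> v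
      = (v \<otimes>\<^bsub>free_group m\<^esub> u) \<otimes>\<^bsub>free_group m\<^esub> s \<otimes>\<^bsub>free_group m\<^esub> inv\<^bsub>free_group m\<^esub> (v \<otimes>\<^bsub>free_group m\<^esub> u)"
    using u v by (simp add: c inv_mult_group m_assoc)
  moreover have "v \<otimes>\<^bsub>free_group m\<^esub> u \<in> carrier (free_group m)" using u v by simp
  ultimately show ?thesis using r s by (auto simp: relator_conjugates_def)
qed

text \<open>Inversion keeps the conjugator and exchanges a relator with its inverse; both signs are
  allowed in \<open>relator_conjugates\<close>.\<close>

lemma relator_conjugates_inv:
  assumes R: "R \<subseteq> carrier (free_group m)" and c: "c \<in> relator_conjugates m R"
  shows "inv\<^bsub>free_group m\<^esub> c \<in> relator_conjugates m R"
proof -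
  interpret group "free_group m" by (rule group_free_group)
  obtain u s r where u: "u \<in> carrier (free_group m)" and r: "r \<in> R"
    and s: "s = r \<or> s = inv\<^bsub>free_group m\<^esub> r"
    and c: "c = u \<otimes>\<^bsub>free_group m\<^esub> s \<otimes>\<^bsub>free_group m\<^esub> inv\<^bsub>free_group m\<^esub> u"
    using c by (auto simp: relator_conjugates_def)
  have rc: "r \<in> carrier (free_group m)" using r R by auto
  have "inv\<^bsub>free_group m\<^esub> c
      = u \<otimes>\<^bsub>free_group m\<^esub> inv\<^bsub>free_group m\<^esub> s \<otimes>\<^bsub>free_group m\<^esub> inv\<^bsub>free_group m\<^esub> u"
    using u s rc by (auto simp: c inv_mult_group m_assoc)
  moreover have "inv\<^bsub>free_group m\<^esub> s = r \<or> inv\<^bsub>free_group m\<^esub> s = inv\<^bsub>free_group m\<^esub> r"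
    using s rc by auto
  ultimately show ?thesis using r u by (auto simp: relator_conjugates_def)
qed

lemma conjugate_product_one: "conjugate_product m R 0 \<one>\<^bsub>free_group m\<^esub>"
  by (simp add: conjugate_product_def)

lemma conjugate_product_single:
  assumes "R \<subseteq> carrier (free_group m)" and "c \<in> relator_conjugates m R"
  shows "conjugate_product m R 1 c"
proof -
  interpret group "free_group m" by (rule group_free_group)
  have "c = foldr (\<otimes>\<^bsub>free_group m\<^esub>) [c] \<one>\<^bsub>free_group m\<^esub>"
    using assms(2) relator_conjugates_closed[OF assms(1)] by auto
  then show ?thesis
    unfolding conjugate_product_def using assms(2) by (intro exI[of _ "[c]"]) simp
qed

lemma foldr_mult_closed:
  assumes "R \<subseteq> carrier (free_group m)" and "set cs \<subseteq> relator_conjugates m R"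
  shows "foldr (\<otimes>\<^bsub>free_group m\<^esub>) cs \<one>\<^bsub>free_group m\<^esub> \<in> carrier (free_group m)"
proof -
  interpret group "free_group m" by (rule group_free_group)
  show ?thesis
    using assms(2) relator_conjugates_closed[OF assms(1)] by (induction cs) auto
qed

lemma conjugate_product_mult:
  assumes R: "R \<subseteq> carrier (free_group m)"
    and "conjugate_product m R k v" and "conjugate_product m R l w"
  shows "conjugate_product m R (k + l) (v \<otimes>\<^bsub>free_group m\<^esub> w)"
proof -
  interpret group "free_group m" by (rule group_free_group)
  obtain cs ds where cs: "length cs = k" "set cs \<subseteq> relator_conjugates m R"
      "v = foldr (\<otimes>\<^bsub>free_group m\<^esub>) cs \<one>\<^bsub>free_group m\<^esub>"
    and ds: "length ds = l" "set ds \<subseteq> relator_conjugates m R"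
      "w = foldr (\<otimes>\<^bsub>free_group m\<^esub>) ds \<one>\<^bsub>free_group m\<^esub>"
    using assms(2,3) by (auto simp: conjugate_product_def)
  have w: "w \<in> carrier (free_group m)" using foldr_mult_closed[OF R ds(2)] ds(3) by simp
  \<comment> \<open>Moving \<open>w\<close> into the starting value of the fold turns the product
    into the fold over \<open>cs @ ds\<close>.\<close>
  have "foldr (\<otimes>\<^bsub>free_group m\<^esub>) cs \<one>\<^bsub>free_group m\<^esub> \<otimes>\<^bsub>free_group m\<^esub> w
      = foldr (\<otimes>\<^bsub>free_group m\<^esub>) cs w"
    using cs(2)
  proof (induction cs)
    case (Cons c cs)
    have "c \<in> carrier (free_group m)"
      using Cons.prems relator_conjugates_closed[OF R] by auto
    then show ?case using Cons foldr_mult_closed[OF R, of cs] w by (simp add: m_assoc)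
  qed (simp add: w)
  then show ?thesis
    unfolding conjugate_product_def using cs ds by (intro exI[of _ "cs @ ds"]) simp
qed

text \<open>Conjugation by \<open>v\<close> is an automorphism, so it can be applied to each factor
  separately and the number of factors stays the same.\<close>

lemma conjugate_product_conj:
  assumes R: "R \<subseteq> carrier (free_group m)"
    and "conjugate_product m R k w" and v: "v \<in> carrier (free_group m)"
  shows "conjugate_product m R k
    (v \<otimes>\<^bsub>free_group m\<^esub> w \<otimes>\<^bsub>free_group m\<^esub> inv\<^bsub>free_group m\<^esub> v)"
proof -
  interpret group "free_group m" by (rule group_free_group)
  let ?conj = "\<lambda>c. v \<otimes>\<^bsub>free_group m\<^esub> c \<otimes>\<^bsub>free_group m\<^esub> inv\<^bsub>free_group m\<^esub> v"
  obtain cs where cs: "length cs = k" "set cs \<subseteq> relator_conjugates m R"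
      "w = foldr (\<otimes>\<^bsub>free_group m\<^esub>) cs \<one>\<^bsub>free_group m\<^esub>"
    using assms(2) by (auto simp: conjugate_product_def)
  have "?conj (foldr (\<otimes>\<^bsub>free_group m\<^esub>) cs \<one>\<^bsub>free_group m\<^esub>)
      = foldr (\<otimes>\<^bsub>free_group m\<^esub>) (map ?conj cs) \<one>\<^bsub>free_group m\<^esub>"
    using cs(2)
  proof (induction cs)
    case (Cons c cs)
    let ?w = "foldr (\<otimes>\<^bsub>free_group m\<^esub>) cs \<one>\<^bsub>free_group m\<^esub>"
    have "c \<in> carrier (free_group m)"
      using Cons.prems relator_conjugates_closed[OF R] by auto
    moreover have "?w \<in> carrier (free_group m)" using foldr_mult_closed[OF R] Cons.prems by simp
    \<comment> \<open>This cancels the inverse of \<open>v\<close> against the \<open>v\<close> that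
      meets it between two neighbouring conjugates.\<close>
    moreover have "inv\<^bsub>free_group m\<^esub> v \<otimes>\<^bsub>free_group m\<^esub> (v \<otimes>\<^bsub>free_group m\<^esub> x) = x"
      if "x \<in> carrier (free_group m)" for x
      using that v by (simp flip: m_assoc)
    ultimately have "?conj (c \<otimes>\<^bsub>free_group m\<^esub> ?w) = ?conj c \<otimes>\<^bsub>free_group m\<^esub> ?conj ?w"
      using v by (simp add: m_assoc)
    then show ?case using Cons by simp
  qed (simp add: v)
  then show ?thesis
    unfolding conjugate_product_def using cs relator_conjugates_conj[OF R _ v]
    by (intro exI[of _ "map ?conj cs"]) auto
qed

lemma conjugate_product_inv:
  assumes R: "R \<subseteq> carrier (free_group m)" and "conjugate_product m R k w"
  shows "conjugate_product m R k (inv\<^bsub>free_group m\<^esub> w)"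
proof -
  interpret group "free_group m" by (rule group_free_group)
  have "conjugate_product m R (length cs)
      (inv\<^bsub>free_group m\<^esub> (foldr (\<otimes>\<^bsub>free_group m\<^esub>) cs \<one>\<^bsub>free_group m\<^esub>))"
    if "set cs \<subseteq> relator_conjugates m R" for cs
    using that
  proof (induction cs)
    case Nil
    show ?case by (simp add: conjugate_product_one)
  next
    case (Cons c cs)
    have "c \<in> carrier (free_group m)"
      using Cons.prems relator_conjugates_closed[OF R] by auto
    moreover have "conjugate_product m R 1 (inv\<^bsub>free_group m\<^esub> c)"
      using Cons.prems by (intro conjugate_product_single relator_conjugates_inv R) simp
    ultimately show ?case
      \<comment> \<open>Inversion reverses the order, so the factor coming from the head
        \<open>c\<close> is now the last one.\<close>
      using conjugate_product_mult[OF R, of "length cs" _ 1 "inv\<^bsub>free_group m\<^esub> c"]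
        Cons foldr_mult_closed[OF R, of cs] by (simp add: inv_mult_group)
  qed
  then show ?thesis using assms(2) by (auto simp: conjugate_product_def)
qed

text \<open>The conjugates of relators generate a normal subgroup containing \<open>R\<close>, hence
  containing the normal closure. This shows that the minimum defining \<open>Area\<close> is
  attained.\<close>

lemma conjugate_product_if_normal_closure:
  assumes R: "R \<subseteq> carrier (free_group m)" and w: "w \<in> normal_closure (free_group m) R"
  shows "\<exists>k. conjugate_product m R k w"
proof -
  interpret group "free_group m" by (rule group_free_group)
  let ?C = "relator_conjugates m R"
  have C: "?C \<subseteq> carrier (free_group m)" by (rule relator_conjugates_closed[OF R])
  have "generate (free_group m) ?C \<lhd> free_group m"
    using C relator_conjugates_conj[OF R] by (rule normal_generateI)
  moreover have "R \<subseteq> ?C"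
  proof
    fix r assume r: "r \<in> R"
    then have "r = \<one>\<^bsub>free_group m\<^esub> \<otimes>\<^bsub>free_group m\<^esub> r \<otimes>\<^bsub>free_group m\<^esub> inv\<^bsub>free_group m\<^esub> \<one>\<^bsub>free_group m\<^esub>"
      using R by auto
    then show "r \<in> ?C" unfolding relator_conjugates_def using r one_closed by blast
  qed
  ultimately have "w \<in> generate (free_group m) ?C"
    using w by (auto simp: normal_closure_def intro: generate.incl)
  \<comment> \<open>Inverses of generators are again relator conjugates, so every element built by
    \<open>generate\<close> is a plain product of them.\<close>
  then show ?thesis
  proof (induction rule: generate.induct)
    case one
    show ?case using conjugate_product_one by blast
  next
    case (incl h)
    then show ?case using conjugate_product_single[OF R] by blast
  next
    case (inv h)
    then show ?case using conjugate_product_single[OF R] relator_conjugates_inv[OF R] by blast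
  next
    case (eng h1 h2)
    then show ?case using conjugate_product_mult[OF R] by blast
  qed
qed

lemma conjugate_product_Area:
  assumes "R \<subseteq> carrier (free_group m)" and "w \<in> normal_closure (free_group m) R"
  shows "conjugate_product m R (Area m R w) w"
  using LeastI_ex[OF conjugate_product_if_normal_closure[OF assms]]
  by (simp add: Area_def conjugate_product_def)

lemma Area_le: "conjugate_product m R k w \<Longrightarrow> Area m R w \<le> k"
  by (simp add: Area_def conjugate_product_def Least_le)

text \<open>Each of the \<open>k\<close> factors over \<open>S\<close> is expanded into at most
  \<open>d\<close> factors over \<open>R\<close>. Different relators may need different numbers of
  factors, hence the bounds instead of exact counts.\<close>

lemma conjugate_product_subst:
  assumes R: "R \<subseteq> carrier (free_group m)"
    and S: "\<And>r. r \<in> S \<Longrightarrow> \<exists>j\<le>d. conjugate_product m R j r"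
    and w: "conjugate_product m S k w"
  shows "\<exists>j\<le>k * d. conjugate_product m R j w"
proof -
  \<comment> \<open>Inversion and conjugation preserve the number of factors, so the bound for
    relators passes to their conjugates.\<close>
  have conj: "\<exists>j\<le>d. conjugate_product m R j c" if c: "c \<in> relator_conjugates m S" for c
    using c S conjugate_product_inv[OF R] conjugate_product_conj[OF R]
    unfolding relator_conjugates_def by blast
  have "\<exists>j\<le>length cs * d. conjugate_product m R j (foldr (\<otimes>\<^bsub>free_group m\<^esub>) cs \<one>\<^bsub>free_group m\<^esub>)"
    if "set cs \<subseteq> relator_conjugates m S" for cs
    using that
  proof (induction cs)
    case Nil
    show ?case by (simp add: conjugate_product_one)
  next
    case (Cons c cs)
    obtain i j where "i \<le> d" "conjugate_product m R i c" "j \<le> length cs * d"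
      "conjugate_product m R j (foldr (\<otimes>\<^bsub>free_group m\<^esub>) cs \<one>\<^bsub>free_group m\<^esub>)"
      using Cons conj[of c] by auto
    then show ?case
      using conjugate_product_mult[OF R] by (intro exI[of _ "i + j"]) simp
  qed
  then show ?thesis using w by (auto simp: conjugate_product_def)
qed

section \<open>Comparison of Dehn functions\<close>

lemma Area_le_Dehn: "w \<in> Rel m n P \<Longrightarrow> Area m R w \<le> Dehn m P R n"
  by (simp add: Dehn_def finite_Rel)

lemma Rel_subset_normal_closure:
  assumes "is_presentation m P R"
  shows "Rel m l P \<subseteq> normal_closure (free_group m) R"
  using assms by (auto simp: is_presentation_def kernel_def Rel_def)

text \<open>Relators lie in the kernel of the evaluation map, and finiteness makes
  \<open>max_relator_length R\<close> a true bound on their lengths.\<close>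

lemma relators_subset_Rel:
  assumes P: "is_presentation m P R" and fin: "finite R"
  shows "R \<subseteq> Rel m (max_relator_length R) P"
proof
  fix r assume r: "r \<in> R"
  have "r \<in> normal_closure (free_group m) R" using r by (auto simp: normal_closure_def)
  then have "r \<in> kernel (free_group m) (fst P) (eval_word P)"
    using P by (simp add: is_presentation_def)
  moreover have "length r \<le> max_relator_length R"
    using r fin by (simp add: max_relator_length_def)
  ultimately show "r \<in> Rel m (max_relator_length R) P" by (simp add: kernel_def Rel_def)
qed

lemma Rel_restrict: "l \<le> k \<Longrightarrow> Rel m l P = {w \<in> Rel m k P. length w \<le> l}"
  by (auto simp: Rel_def)

lemma Rel_eq_mono: "Rel m k P = Rel m k Q \<Longrightarrow> l \<le> k \<Longrightarrow> Rel m l P = Rel m l Q"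
  using Rel_restrict[of l k m P] Rel_restrict[of l k m Q] by simp

text \<open>Here \<open>P\<close> stands for a group of the sequence and \<open>Q\<close> for the
  limit. Agreement at \<open>n\<close> transfers words from \<open>P\<close> to \<open>Q\<close>;
  agreement at the maximal relator length transfers the relators in \<open>S\<close> back to
  \<open>P\<close>.\<close>

lemma Dehn_le_mult:
  assumes P: "is_presentation m P R" and Q: "is_presentation m Q S" and fin: "finite S"
    and n: "Rel m n P = Rel m n Q"
    and L: "Rel m (max_relator_length S) P = Rel m (max_relator_length S) Q"
  shows "Dehn m P R n \<le> Dehn m Q S n * Dehn m P R (max_relator_length S)"
proof -
  let ?L = "max_relator_length S"
  have R: "R \<subseteq> carrier (free_group m)" and S: "S \<subseteq> carrier (free_group m)"
    using P Q by (simp_all add: is_presentation_def)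
  have relators: "\<exists>j\<le>Dehn m P R ?L. conjugate_product m R j r" if "r \<in> S" for r
  proof -
    have r: "r \<in> Rel m ?L P" using relators_subset_Rel[OF Q fin] L that by auto
    then show ?thesis
      using conjugate_product_Area[OF R, of r] Rel_subset_normal_closure[OF P] Area_le_Dehn
      by blast
  qed
  have "Area m R w \<le> Dehn m Q S n * Dehn m P R ?L" if w: "w \<in> Rel m n P" for w
  proof -
    have wQ: "w \<in> Rel m n Q" using w n by simp
    then have "conjugate_product m S (Area m S w) w"
      using conjugate_product_Area[OF S] Rel_subset_normal_closure[OF Q] by blast
    then obtain j where "j \<le> Area m S w * Dehn m P R ?L" "conjugate_product m R j w"
      using conjugate_product_subst[OF R relators] by blast
    then have "Area m R w \<le> Area m S w * Dehn m P R ?L" using Area_le by force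
    also have "\<dots> \<le> Dehn m Q S n * Dehn m P R ?L" using Area_le_Dehn[OF wQ] by simp
    finally show ?thesis .
  qed
  \<comment> \<open>\<open>Max_le_iff\<close> requires a nonempty set; the empty word is always a
    relation.\<close>
  moreover have "Rel m n P \<noteq> {}" using Nil_in_Rel[of m n P] by blast
  ultimately show ?thesis
    unfolding Dehn_def[of m P R n] by (subst Max_le_iff) (auto simp: finite_Rel)
qed

section \<open>Convergence of marked groups\<close>

text \<open>An isomorphism matching the markings commutes with evaluation of words and, being
  injective, preserves which words are trivial. This covers the clause of \<open>gg_dist\<close>
  with value 0.\<close>

lemma Rel_eq_if_same_marked:
  assumes P: "P \<in> marked_groups m" and Q: "Q \<in> marked_groups m" and same: "same_marked P Q"
  shows "Rel m l P = Rel m l Q"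
proof -
  obtain G X H Y where PQ: "P = (G, X)" "Q = (H, Y)" by (metis surj_pair)
  obtain h where h: "h \<in> iso G H" and Y: "map h X = Y"
    using same PQ by (auto simp: same_marked_def)
  interpret group_hom G H h
    using P Q PQ h by (simp add: group_hom_def group_hom_axioms_def marked_groups_def iso_def)
  have letter: "eval_letter Q a = h (eval_letter P a)" if "snd a < m" for a
  proof -
    have "snd a < length X" "X ! snd a \<in> carrier G"
      using that P PQ by (auto simp: marked_groups_def)
    then show ?thesis by (simp add: PQ eval_letter_def Y[symmetric])
  qed
  have "eval_word Q w = h (eval_word P w)" if "snd ` set w \<subseteq> {..<m}" for w
    using that
  proof (induction w)
    case Nil
    show ?case by (simp add: eval_word_def PQ)
  next
    case (Cons a w)
    then have "eval_letter P a \<in> carrier G" "eval_word P w \<in> carrier G"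
      using eval_letter_closed[of G X m a] eval_word_closed[of G X m w] P PQ by auto
    then show ?case using Cons letter[of a] by (simp add: eval_word_def PQ)
  qed
  moreover have "eval_word P w \<in> carrier G" if "snd ` set w \<subseteq> {..<m}" for w
    using that eval_word_closed[of G X m w] P PQ by simp
  moreover have "h x = \<one>\<^bsub>H\<^esub> \<longleftrightarrow> x = \<one>\<^bsub>G\<^esub>" if "x \<in> carrier G" for x
  proof -
    have "inj_on h (carrier G)" using h by (simp add: iso_def bij_betw_def)
    then show ?thesis using inj_on_eq_iff[of h "carrier G" x "\<one>\<^bsub>G\<^esub>"] that by simp
  qed
  ultimately show ?thesis by (auto simp: Rel_def free_group_def PQ)
qed

text \<open>For distinct marked groups the distance is the exponential of minus the greatest length
  of agreement, so that length exceeds \<open>l\<close>, and agreement passes down to shorter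
  lengths.\<close>

lemma Rel_eq_if_gg_dist_less:
  assumes P: "P \<in> marked_groups m" and Q: "Q \<in> marked_groups m"
    and dist: "gg_dist m P Q < exp (- real l)"
  shows "Rel m l P = Rel m l Q"
proof (cases "same_marked P Q")
  case True
  then show ?thesis by (rule Rel_eq_if_same_marked[OF P Q])
next
  case False
  let ?E = "\<lambda>l. Rel m l P = Rel m l Q"
  obtain b where b: "\<not> ?E b" using same_marked_if_Rel_eq[OF P Q] False by blast
  \<comment> \<open>Agreement at a length beyond \<open>b\<close> would force agreement at
    \<open>b\<close>. Together with agreement at 0, this makes \<open>GREATEST\<close> well
    defined.\<close>
  have bound: "k \<le> b" if "?E k" for k
    using Rel_eq_mono[OF that, of b] b by (meson nat_le_linear)
  have "Rel m 0 P' = {[]}" for P' :: "'c monoid \<times> 'c list"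
    using Nil_in_Rel[of m 0 P'] by (auto simp: Rel_def)
  then have "?E 0" using Nil_in_Rel[of m 0 P] Nil_in_Rel[of m 0 Q] by (auto simp: Rel_def)
  then have "?E (GREATEST l. ?E l)" by (rule GreatestI_nat) (use bound in blast)
  moreover have "l \<le> (GREATEST l. ?E l)" using dist False by (simp add: gg_dist_def)
  ultimately show ?thesis by (rule Rel_eq_mono)
qed

theorem theorem1:
  fixes m n L :: nat
    and G :: "nat \<Rightarrow> 'a monoid" and X :: "nat \<Rightarrow> 'a list" and R :: "nat \<Rightarrow> letter list set"
    and G\<^sub>0 :: "'b monoid" and X\<^sub>0 :: "'b list" and R\<^sub>0 :: "letter list set"
  assumes "\<And>i. i \<ge> 1 \<Longrightarrow> (G i, X i) \<in> marked_groups m"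
    and "(G\<^sub>0, X\<^sub>0) \<in> marked_groups m"
    and "(\<lambda>i. gg_dist m (G i, X i) (G\<^sub>0, X\<^sub>0)) \<longlonglongrightarrow> 0"
    and "\<And>i. i \<ge> 1 \<Longrightarrow> is_presentation m (G i, X i) (R i)"
    and "is_presentation m (G\<^sub>0, X\<^sub>0) R\<^sub>0" and "finite R\<^sub>0"
    and "L = max_relator_length R\<^sub>0"
  shows "limsup (\<lambda>i. ereal (real (Dehn m (G i, X i) (R i) n)) /
                     ereal (real (Dehn m (G i, X i) (R i) L)))
         \<le> ereal (real (Dehn m (G\<^sub>0, X\<^sub>0) R\<^sub>0 n))"
proof (rule Limsup_bounded)
  let ?D = "\<lambda>i. Dehn m (G i, X i) (R i)" and ?d = "Dehn m (G\<^sub>0, X\<^sub>0) R\<^sub>0 n"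
  \<comment> \<open>The radius for \<open>max n L\<close> yields agreement at both lengths
    \<open>n\<close> and \<open>L\<close> at once.\<close>
  have "\<forall>\<^sub>F i in sequentially. gg_dist m (G i, X i) (G\<^sub>0, X\<^sub>0) < exp (- real (max n L))"
    using assms(3) by (rule order_tendstoD) simp
  then show "\<forall>\<^sub>F i in sequentially. ereal (real (?D i n)) / ereal (real (?D i L)) \<le> ereal (real ?d)"
    \<comment> \<open>The sequence starts at index 1, so index 0 is discarded.\<close>
    using eventually_ge_at_top[of 1]
  proof eventually_elim
    case (elim i)
    have "Rel m (max n L) (G i, X i) = Rel m (max n L) (G\<^sub>0, X\<^sub>0)"
      using Rel_eq_if_gg_dist_less assms(1,2) elim by blast
    then have "Rel m n (G i, X i) = Rel m n (G\<^sub>0, X\<^sub>0)" "Rel m L (G i, X i) = Rel m L (G\<^sub>0, X\<^sub>0)"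
      by (rule Rel_eq_mono; simp)+
    then have le: "?D i n \<le> ?d * ?D i L"
      using Dehn_le_mult[OF assms(4)[OF elim(2)] assms(5,6)] assms(7) by simp
    show ?case
    proof (cases "?D i L = 0")
      case True
      \<comment> \<open>Then the quotient is \<open>0 / 0\<close>, which is \<open>0\<close> in \<open>ereal\<close>.\<close>
      then show ?thesis using le by simp
    next
      case False
      have "real (?D i n) \<le> real ?d * real (?D i L)"
        using le by (metis of_nat_le_iff of_nat_mult)
      then show ?thesis using False by (simp add: divide_le_eq)
    qed
  qed
qed

end
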